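(* Let $\mathbf L\simeq\mathbb Z^n$ be a lattice of rank $n\ge2$, and consider the free abelian group on the symbols $[\Lambda]$, where $\Lambda$ runs over the basic simplicial cones in $\mathbf L\otimes\mathbb R$. For every $3\le k\le n$, each relation of type $(\mathrm R_k)$ is a consequence of (i.e. lies in the subgroup generated by) relations of type $(\mathrm R_2)$.
   Context: A basic simplicial cone in $\mathbf L_{\mathbb R}=\mathbf L\otimes\mathbb R$ is a cone of the form $\Lambda=\mathbb R_{\ge0}e_1+\dots+\mathbb R_{\ge0}e_n$, where $e_1,\dots,e_n$ is a basis of the lattice $\mathbf L$. For an integer $2\le k\le n$, the relations $(\mathrm R_k)$ are: for every basic simplicial cone $\Lambda$ and every ordered basis $e_1,\dots,e_n$ of $\mathbf L$ spanning $\Lambda$, $$[\Lambda]=[\Lambda_1]+\dots+[\Lambda_k],$$ where, for $1\le i\le k$, $\Lambda_i$ is the basic simplicial cone spanned by the basis obtained from $e_1,\dots,e_n$ by replacing $e_i$ with $e_1+\dots+e_k$. (Thus the "relation" is identified with the element $[\Lambda]-[\Lambda_1]-\dots-[\Lambda_k]$ of the free abelian group.) *)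

theory Defs
  imports Complex_Main "HOL-Algebra.Free_Abelian_Groups"
begin

text \<open>
  A lattice is given inside its real span: \<open>L\<close> is the group of integer combinations of
  some basis of the real vector space \<^typ>\<open>'a\<close>, so that \<^typ>\<open>'a\<close> plays the role of
  \<open>L \<otimes> \<real>\<close>.
\<close>

definition is_lattice :: "'a::real_vector set \<Rightarrow> nat \<Rightarrow> bool" where
  "is_lattice L n \<longleftrightarrow>
     (\<exists>b :: nat \<Rightarrow> 'a.
        inj_on b {1..n} \<and> independent (b ` {1..n}) \<and> span (b ` {1..n}) = UNIV \<and>
        L = {(\<Sum>i=1..n. of_int (c i) *\<^sub>R b i) | c :: nat \<Rightarrow> int. True})"

text \<open>Only the values of \<open>e\<close> on \<open>{1..n}\<close> matter, here and below.\<close>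

definition lattice_basis :: "'a::real_vector set \<Rightarrow> nat \<Rightarrow> (nat \<Rightarrow> 'a) \<Rightarrow> bool" where
  "lattice_basis L n e \<longleftrightarrow>
     (\<forall>i\<in>{1..n}. e i \<in> L) \<and>
     (\<forall>x\<in>L. \<exists>!c :: nat \<Rightarrow> int.
        c \<in> extensional {1..n} \<and> x = (\<Sum>i=1..n. of_int (c i) *\<^sub>R e i))"

definition cone_of :: "nat \<Rightarrow> (nat \<Rightarrow> 'a::real_vector) \<Rightarrow> 'a set" where
  "cone_of n e = {(\<Sum>i=1..n. t i *\<^sub>R e i) | t :: nat \<Rightarrow> real. \<forall>i\<in>{1..n}. 0 \<le> t i}"

definition basic_simplicial_cones :: "'a::real_vector set \<Rightarrow> nat \<Rightarrow> 'a set set" where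
  "basic_simplicial_cones L n = {cone_of n e | e. lattice_basis L n e}"

definition R_relation :: "nat \<Rightarrow> nat \<Rightarrow> (nat \<Rightarrow> 'a::real_vector) \<Rightarrow> 'a set \<Rightarrow>\<^sub>0 int" where
  "R_relation n k e =
     frag_of (cone_of n e) - (\<Sum>i=1..k. frag_of (cone_of n (e(i := (\<Sum>j=1..k. e j)))))"

definition R_relations :: "'a::real_vector set \<Rightarrow> nat \<Rightarrow> nat \<Rightarrow> ('a set \<Rightarrow>\<^sub>0 int) set" where
  "R_relations L n k = {R_relation n k e | e. lattice_basis L n e}"

end

theory Submission imports Defs "HOL-Combinatorics.Permutations" begin

text \<open>
  By induction, \<open>(R\<^bsub>k+1\<^esub>)\<close> follows from \<open>(R\<^sub>k)\<close> and \<open>(R\<^sub>2)\<close>. Put \<open>f = e\<^sub>1 + \<dots> + e\<^sub>k\<close> and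
  \<open>s = f + e\<^bsub>k+1\<^esub>\<close>. Subdivide the cone of \<open>e\<close> by \<open>(R\<^sub>k)\<close> along \<open>f\<close>, then cut the \<open>i\<close>-th piece
  along \<open>s\<close> by applying \<open>(R\<^sub>2)\<close> to its edges \<open>f\<close> and \<open>e\<^bsub>k+1\<^esub>\<close>. The halves containing \<open>e\<^bsub>k+1\<^esub>\<close>
  are the first \<open>k\<close> pieces of \<open>(R\<^bsub>k+1\<^esub>)\<close>, and the other halves reassemble to the last piece by
  \<open>(R\<^sub>k)\<close> for the basis in which \<open>s\<close> replaces \<open>e\<^bsub>k+1\<^esub>\<close>.
\<close>

section \<open>Sums of lattice vectors\<close>

lemma is_lattice_add:
  assumes "is_lattice L n" "x \<in> L" "y \<in> L"
  shows "x + y \<in> L"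
proof -
  obtain b :: "nat \<Rightarrow> 'a" where
    L: "L = {(\<Sum>i=1..n. of_int (c i) *\<^sub>R b i) | c :: nat \<Rightarrow> int. True}"
    using assms(1) unfolding is_lattice_def by blast
  from assms obtain c d :: "nat \<Rightarrow> int" where
    "x = (\<Sum>i=1..n. of_int (c i) *\<^sub>R b i)" "y = (\<Sum>i=1..n. of_int (d i) *\<^sub>R b i)"
    unfolding L by blast
  then have "x + y = (\<Sum>i=1..n. of_int (c i + d i) *\<^sub>R b i)"
    by (simp add: sum.distrib scaleR_add_left)
  then show ?thesis unfolding L by (auto intro!: exI[of _ "\<lambda>i. c i + d i"])
qed

lemma is_lattice_zero:
  assumes "is_lattice L n"
  shows "0 \<in> L"
proof -
  obtain b :: "nat \<Rightarrow> 'a" where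
    L: "L = {(\<Sum>i=1..n. of_int (c i) *\<^sub>R b i) | c :: nat \<Rightarrow> int. True}"
    using assms(1) unfolding is_lattice_def by blast
  show ?thesis unfolding L by (auto intro!: exI[of _ "\<lambda>i. 0"])
qed

lemma is_lattice_sum:
  assumes "is_lattice L n" "\<And>j. j \<in> J \<Longrightarrow> x j \<in> L"
  shows "sum x J \<in> L"
  using assms(2)
  by (induction J rule: infinite_finite_induct)
    (auto intro: is_lattice_add[OF assms(1)] is_lattice_zero[OF assms(1)])

section \<open>Changes of lattice basis\<close>

text \<open>\<open>T\<close> turns coordinates with respect to \<open>e'\<close> into coordinates
  with respect to \<open>e\<close>; surjectivity of \<open>T\<close> gives existence of coordinates
  for \<open>e'\<close>, injectivity gives uniqueness.\<close>

lemma lattice_basis_transfer: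
  fixes T :: "(nat \<Rightarrow> int) \<Rightarrow> nat \<Rightarrow> int"
  assumes e: "lattice_basis L n e" and mem: "\<And>i. i \<in> {1..n} \<Longrightarrow> e' i \<in> L"
    and T: "bij_betw T (extensional {1..n}) (extensional {1..n})"
    and eq: "\<And>c. c \<in> extensional {1..n} \<Longrightarrow>
      (\<Sum>i=1..n. of_int (c i) *\<^sub>R e' i) = (\<Sum>i=1..n. of_int (T c i) *\<^sub>R e i)"
  shows "lattice_basis L n e'"
  unfolding lattice_basis_def
proof (intro conjI ballI)
  fix x assume "x \<in> L"
  then have "\<exists>!c. c \<in> extensional {1..n} \<and> x = (\<Sum>i=1..n. of_int (c i) *\<^sub>R e i)"
    using e unfolding lattice_basis_def by blast
  then obtain c where c: "c \<in> extensional {1..n}" "x = (\<Sum>i=1..n. of_int (c i) *\<^sub>R e i)"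
    and uniq: "\<And>d. d \<in> extensional {1..n} \<Longrightarrow> x = (\<Sum>i=1..n. of_int (d i) *\<^sub>R e i) \<Longrightarrow> d = c"
    by (elim ex1E) blast
  obtain d where d: "d \<in> extensional {1..n}" "T d = c"
    using T c(1) by (metis bij_betw_imp_surj_on imageE)
  show "\<exists>!c. c \<in> extensional {1..n} \<and> x = (\<Sum>i=1..n. of_int (c i) *\<^sub>R e' i)"
  proof (rule ex1I[of _ d], intro conjI)
    show "x = (\<Sum>i=1..n. of_int (d i) *\<^sub>R e' i)"
      using eq[OF d(1)] d(2) c(2) by simp
    fix d' assume d': "d' \<in> extensional {1..n} \<and> x = (\<Sum>i=1..n. of_int (d' i) *\<^sub>R e' i)"
    then have "T d' = c"
      using eq T by (intro uniq) (auto dest: bij_betwE)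
    then show "d' = d"
      using d d' T by (metis bij_betw_def inj_onD)
  qed (fact d(1))
qed (fact mem)

text \<open>On coordinates this is a unimodular shear: the \<open>i\<close>-th coordinate is added
  to those in \<open>J\<close>.\<close>

lemma lattice_basis_add_sum:
  assumes lat: "is_lattice L n" and e: "lattice_basis L n e"
    and i: "i \<in> {1..n}" and J: "J \<subseteq> {1..n}" "i \<notin> J"
  shows "lattice_basis L n (e(i := e i + sum e J))"
proof (rule lattice_basis_transfer[OF e])
  define T :: "int \<Rightarrow> (nat \<Rightarrow> int) \<Rightarrow> nat \<Rightarrow> int"
    where "T a c j = (if j \<in> J then c j + a * c i else c j)" for a c j
  have T_ext: "T a c \<in> extensional {1..n}" if "c \<in> extensional {1..n}" for a c
    using that J by (auto simp: T_def extensional_def)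
  \<comment> \<open>As \<open>i \<notin> J\<close>, a shear fixes coordinate \<open>i\<close>, so
    the factors of successive shears add and \<open>T (-1)\<close> inverts
    \<open>T 1\<close>.\<close>
  have T_inv: "T a (T b c) = c" if "a + b = 0" for a b c
  proof -
    have "a * c i + b * c i = 0" using that by (metis distrib_right mult_zero_left)
    then show ?thesis using J by (auto simp: T_def fun_eq_iff)
  qed
  show "bij_betw (T 1) (extensional {1..n}) (extensional {1..n})"
    by (rule bij_betw_byWitness[where f' = "T (-1)"]) (use T_ext in \<open>auto simp: T_inv simp del: One_nat_def\<close>)
  have mem: "e j \<in> L" if "j \<in> {1..n}" for j
    using e that unfolding lattice_basis_def by blast
  show "(e(i := e i + sum e J)) j \<in> L" if "j \<in> {1..n}" for j
    using that J mem i by (auto intro!: is_lattice_add[OF lat] is_lattice_sum[OF lat])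
  fix c :: "nat \<Rightarrow> int"
  have "(\<Sum>j=1..n. of_int (c j) *\<^sub>R (e(i := e i + sum e J)) j)
      = (\<Sum>j=1..n. of_int (c j) *\<^sub>R e j + (if j = i then of_int (c i) *\<^sub>R sum e J else 0))"
    by (rule sum.cong) (auto simp: scaleR_add_right)
  also have "\<dots> = (\<Sum>j=1..n. of_int (c j) *\<^sub>R e j) + of_int (c i) *\<^sub>R sum e J"
    using i by (simp add: sum.distrib)
  also have "of_int (c i) *\<^sub>R sum e J = (\<Sum>j=1..n. if j \<in> J then of_int (c i) *\<^sub>R e j else 0)"
    using J by (simp add: scaleR_sum_right sum.If_cases inf_absorb2)
  also have "(\<Sum>j=1..n. of_int (c j) *\<^sub>R e j) + \<dots> = (\<Sum>j=1..n. of_int (T 1 c j) *\<^sub>R e j)"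
    unfolding sum.distrib[symmetric] by (rule sum.cong) (auto simp: T_def scaleR_add_left)
  finally show "(\<Sum>j=1..n. of_int (c j) *\<^sub>R (e(i := e i + sum e J)) j)
      = (\<Sum>j=1..n. of_int (T 1 c j) *\<^sub>R e j)" .
qed

text \<open>Splitting \<open>e i\<close> off the sum reduces this to the shear. With
  \<open>J = {1..k}\<close> it shows that the pieces of a subdivision are basic cones.\<close>

lemma lattice_basis_upd_sum:
  assumes "is_lattice L n" "lattice_basis L n e" "J \<subseteq> {1..n}" "i \<in> J"
  shows "lattice_basis L n (e(i := sum e J))"
proof -
  have "sum e J = e i + sum e (J - {i})"
    using assms finite_subset by (intro sum.remove) auto
  moreover have "lattice_basis L n (e(i := e i + sum e (J - {i})))"
    using assms by (intro lattice_basis_add_sum) auto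
  ultimately show ?thesis by metis
qed

lemma lattice_basis_permute:
  assumes e: "lattice_basis L n e" and p: "p permutes {1..n}"
  shows "lattice_basis L n (e \<circ> p)"
proof (rule lattice_basis_transfer[OF e])
  have q: "inv_into UNIV p permutes {1..n}" using p by (rule permutes_inv)
  have ext: "c \<circ> r \<in> extensional {1..n}"
    if "c \<in> extensional {1..n}" "r permutes {1..n}" for c :: "nat \<Rightarrow> int" and r
    using that by (auto simp: extensional_def permutes_def)
  show "bij_betw (\<lambda>c :: nat \<Rightarrow> int. c \<circ> inv_into UNIV p) (extensional {1..n}) (extensional {1..n})"
    using ext p q
    by (intro bij_betw_byWitness[where f' = "\<lambda>c. c \<circ> p"])
      (auto simp: fun_eq_iff permutes_inverses[OF p])
  show "(e \<circ> p) i \<in> L" if "i \<in> {1..n}" for i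
    using e permutes_in_image[OF p] that unfolding lattice_basis_def by auto
  fix c :: "nat \<Rightarrow> int"
  show "(\<Sum>i=1..n. of_int (c i) *\<^sub>R (e \<circ> p) i) = (\<Sum>i=1..n. of_int ((c \<circ> inv_into UNIV p) i) *\<^sub>R e i)"
    using sum.permute[OF p, of "\<lambda>i. of_int ((c \<circ> inv_into UNIV p) i) *\<^sub>R e i"]
    by (simp add: o_def permutes_inverses[OF p])
qed

section \<open>Reordering the edges of a cone\<close>

lemma cone_of_permute_subset:
  assumes p: "p permutes {1..n}"
  shows "cone_of n e \<subseteq> cone_of n (e \<circ> p)"
proof
  fix x assume "x \<in> cone_of n e"
  then obtain t where t: "\<forall>i\<in>{1..n}. 0 \<le> t i" "x = (\<Sum>i=1..n. t i *\<^sub>R e i)"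
    unfolding cone_of_def by blast
  have "x = (\<Sum>i=1..n. (t \<circ> p) i *\<^sub>R (e \<circ> p) i)"
    using sum.permute[OF p, of "\<lambda>i. t i *\<^sub>R e i"] t(2) by (simp add: o_def)
  moreover have "\<forall>i\<in>{1..n}. 0 \<le> (t \<circ> p) i"
    using t(1) permutes_in_image[OF p] by auto
  ultimately show "x \<in> cone_of n (e \<circ> p)"
    unfolding cone_of_def by blast
qed

text \<open>The converse inclusion is the same lemma for the inverse permutation and
  \<open>e \<circ> p\<close>.\<close>

lemma cone_of_permute:
  assumes p: "p permutes {1..n}"
  shows "cone_of n (e \<circ> p) = cone_of n e"
  using cone_of_permute_subset[OF p, of e]
    cone_of_permute_subset[OF permutes_inv[OF p], of "e \<circ> p"]
  by (simp add: o_assoc[symmetric] permutes_inv_o[OF p] subset_antisym)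

text \<open>One transposition takes \<open>a\<close> to \<open>i\<close>; a second one corrects the
  image of \<open>b\<close> and fixes \<open>i\<close>, which is neither \<open>q b\<close> nor
  \<open>j\<close>.\<close>

lemma ex_permutes_pair:
  assumes "a \<in> S" "b \<in> S" "i \<in> S" "j \<in> S" "a \<noteq> b" "i \<noteq> j"
  obtains p where "p permutes S" "p a = i" "p b = j"
proof -
  define q where "q = transpose a i"
  have q: "q permutes S" unfolding q_def using assms by (intro permutes_swap_id)
  have "q b \<in> S" using permutes_in_image[OF q] assms by blast
  then have r: "transpose (q b) j permutes S" using assms by (intro permutes_swap_id)
  have qb: "q b \<noteq> i"
    using assms by (auto simp: q_def transpose_def)
  show thesis
  proof
    show "transpose (q b) j \<circ> q permutes S" by (rule permutes_compose[OF q r])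
    show "(transpose (q b) j \<circ> q) a = i"
      using qb assms by (simp add: q_def transpose_def)
  qed simp
qed

text \<open>Moves the permutation outermost, where \<open>cone_of_permute\<close> removes
  it.\<close>

lemma upd_comp_bij: "inj p \<Longrightarrow> (e \<circ> p)(a := v) = e(p a := v) \<circ> p"
  by (auto simp: fun_eq_iff inj_eq)

section \<open>Relations in the free abelian group\<close>

text \<open>\<open>R_relation n 2\<close> cuts only along the first two edges. Reordering the basis
  brings any pair there without changing the cones.\<close>

lemma R_relation_2_pair:
  assumes e: "lattice_basis L n e" and i: "i \<in> {1..n}" and j: "j \<in> {1..n}" and ij: "i \<noteq> j"
  shows "frag_of (cone_of n e) - frag_of (cone_of n (e(i := e i + e j)))
    - frag_of (cone_of n (e(j := e i + e j))) \<in> R_relations L n 2"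
proof -
  have n: "1 \<in> {1..n}" "2 \<in> {1..n}" using i j ij by auto
  obtain p where p: "p permutes {1..n}" "p 1 = i" "p 2 = j"
    using ex_permutes_pair[OF n i j _ ij] by auto
  have inj: "inj p" using p(1) by (rule permutes_inj)
  have "R_relation n 2 (e \<circ> p) = frag_of (cone_of n e)
      - frag_of (cone_of n (e(i := e i + e j))) - frag_of (cone_of n (e(j := e i + e j)))"
    unfolding R_relation_def upd_comp_bij[OF inj] cone_of_permute[OF p(1)]
    using p by (simp add: numeral_2_eq_2)
  then show ?thesis
    unfolding R_relations_def using lattice_basis_permute[OF e p(1)] by force
qed

text \<open>Everything telescopes: the cones with \<open>f\<close> alone cancel against the first
  term, those with both \<open>f\<close> and \<open>s\<close> against the last.\<close>

lemma R_relation_Suc: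
  fixes e :: "nat \<Rightarrow> 'a::real_vector"
  assumes "k \<ge> 1"
  defines "f \<equiv> \<Sum>j=1..k. e j" and "s \<equiv> \<Sum>j=1..Suc k. e j"
  shows "R_relation n (Suc k) e = R_relation n k e
    + (\<Sum>i=1..k. frag_of (cone_of n (e(i := f))) - frag_of (cone_of n (e(i := s)))
        - frag_of (cone_of n (e(i := f, Suc k := s))))
    - R_relation n k (e(Suc k := s))"
proof -
  \<comment> \<open>The two bases differ only at \<open>Suc k\<close>, outside the range of
    summation.\<close>
  have "(\<Sum>j=1..k. (e(Suc k := s)) j) = f"
    unfolding f_def by (rule sum.cong) auto
  moreover have "(\<Sum>i=1..k. frag_of (cone_of n (e(Suc k := s, i := f))))
      = (\<Sum>i=1..k. frag_of (cone_of n (e(i := f, Suc k := s))))"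
    by (rule sum.cong) (auto simp: fun_upd_twist)
  ultimately show ?thesis
    unfolding R_relation_def f_def[symmetric] s_def[symmetric]
    by (simp add: sum_subtractf)
qed

text \<open>For \<open>k = 2\<close> this puts the generators into the group, so that they generate
  a subgroup.\<close>

lemma R_relation_carrier:
  assumes lat: "is_lattice L n" and e: "lattice_basis L n e" and k: "k \<le> n"
  shows "R_relation n k e \<in> carrier (free_Abelian_group (basic_simplicial_cones L n))"
proof -
  let ?G = "free_Abelian_group (basic_simplicial_cones L n)"
  have "lattice_basis L n (e(i := \<Sum>j=1..k. e j))" if "i \<in> {1..k}" for i
    using lattice_basis_upd_sum[OF lat e, of "{1..k}" i] that k by auto
  then have "(\<Sum>i=1..k. frag_of (cone_of n (e(i := \<Sum>j=1..k. e j)))) \<in> carrier ?G"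
    by (intro sum_closed_free_Abelian_group) (auto simp: basic_simplicial_cones_def)
  moreover have "frag_of (cone_of n e) \<in> carrier ?G"
    using e by (auto simp: basic_simplicial_cones_def)
  ultimately show ?thesis
    unfolding R_relation_def carrier_free_Abelian_group_iff
    by (rule order_trans[OF keys_diff Un_least, rotated])
qed

lemma R_relation_in_generate:
  assumes lat: "is_lattice L n" and "2 \<le> k" "k \<le> n" "lattice_basis L n e"
  shows "R_relation n k e
    \<in> generate (free_Abelian_group (basic_simplicial_cones L n)) (R_relations L n 2)"
  using assms(2-)
proof (induction k arbitrary: e rule: dec_induct)
  case base
  then show ?case unfolding R_relations_def by (auto intro: generate.incl)
next
  case (step k)
  let ?G = "free_Abelian_group (basic_simplicial_cones L n)"
  let ?H = "generate ?G (R_relations L n 2)"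
  interpret subgroup ?H ?G
    using lat step R_relation_carrier[OF lat]
    by (intro group.generate_is_subgroup) (auto simp: R_relations_def)
  have add: "x + y \<in> ?H" if "x \<in> ?H" "y \<in> ?H" for x y
    using m_closed[OF that] by simp
  \<comment> \<open>Inversion in \<open>?G\<close> is negation on its carrier, hence the appeal to
    \<open>mem_carrier\<close>.\<close>
  have diff: "x - y \<in> ?H" if "x \<in> ?H" "y \<in> ?H" for x y
    using m_closed[OF that(1) m_inv_closed[OF that(2)]] mem_carrier[OF that(2)]
    by (simp add: carrier_free_Abelian_group_iff)
  have sum: "sum g A \<in> ?H" if "\<And>i. i \<in> A \<Longrightarrow> g i \<in> ?H" for g and A :: "nat set"
    using that one_closed by (induction A rule: infinite_finite_induct) (auto intro: add)
  define f where "f = (\<Sum>j=1..k. e j)"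
  define s where "s = (\<Sum>j=1..Suc k. e j)"
  have s: "s = f + e (Suc k)" by (simp add: s_def f_def)
  have f_basis: "lattice_basis L n (e(i := f))" if "i \<in> {1..k}" for i
    using lattice_basis_upd_sum[OF lat step.prems(2), of "{1..k}" i] that step.prems(1)
    by (auto simp: f_def)
  have s_basis: "lattice_basis L n (e(Suc k := s))"
    using lattice_basis_upd_sum[OF lat step.prems(2), of "{1..Suc k}" "Suc k"] step.prems(1)
    by (auto simp: s_def)
  \<comment> \<open>In the basis \<open>e(i := f)\<close> the entries at \<open>i\<close> and
    \<open>Suc k\<close> are \<open>f\<close> and \<open>e (Suc k)\<close>, with sum
    \<open>s\<close>; the double update at \<open>i\<close> collapses to
    \<open>e(i := s)\<close>.\<close>
  have pair: "frag_of (cone_of n (e(i := f))) - frag_of (cone_of n (e(i := s)))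
      - frag_of (cone_of n (e(i := f, Suc k := s))) \<in> ?H" if "i \<in> {1..k}" for i
    using generate.incl[OF R_relation_2_pair[OF f_basis[OF that], of i "Suc k"], of ?G]
      that step.prems(1) by (simp add: s)
  have "R_relation n k e \<in> ?H" and "R_relation n k (e(Suc k := s)) \<in> ?H"
    using step.IH step.prems s_basis by auto
  then have "R_relation n k e
      + (\<Sum>i=1..k. frag_of (cone_of n (e(i := f))) - frag_of (cone_of n (e(i := s)))
          - frag_of (cone_of n (e(i := f, Suc k := s))))
      - R_relation n k (e(Suc k := s)) \<in> ?H"
    by (intro diff[OF add[OF _ sum[OF pair]]])
  moreover have "1 \<le> k" using step.hyps by simp
  ultimately show ?case
    using R_relation_Suc[of k n e] by (simp only: f_def s_def)
qed

theorem lemma8: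
  fixes L :: "'a::real_vector set" and n :: nat
  assumes "is_lattice L n" and "n \<ge> 2"
  shows "\<forall>k. 3 \<le> k \<and> k \<le> n \<longrightarrow>
           (\<forall>r \<in> R_relations L n k.
              r \<in> generate (free_Abelian_group (basic_simplicial_cones L n)) (R_relations L n 2))"
  using R_relation_in_generate[OF assms(1)] by (auto simp: R_relations_def)

end
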